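(* For all terms $f$ and $u$, the term $Z\{f\}\,u$ reduces in finitely many steps to $f\;{\bf tagged}\{Z\{f\}, K u\}\;u$.
   Context: Terms are given by the grammar $p ::= S \mid K \mid p\,q \mid y$, where $S$ and $K$ are constants, $y$ ranges over term variables, and application is left-associative. One-step reduction is the compatible closure (reduction may occur in any subterm) of the rules $S\,M\,N\,P \longrightarrow M\,P\,(N\,P)$ and $K\,M\,N \longrightarrow M$; "reduces in finitely many steps" means its reflexive–transitive closure. Let $I = SKK$ and let ${\bf fv}(t)$ denote the set of variables occurring in $t$. Star abstraction $\lambda x.t$ is defined by recursion on $t$: if $t$ is a variable $y$, then $\lambda x.t = I$ if $y=x$ and $K\,y$ otherwise; $\lambda x.S = KS$; $\lambda x.K = KK$; for $t = t_1 t_2$, $\lambda x.t = S(\lambda x.t_1)(\lambda x.t_2)$ if $x\in{\bf fv}(t_1t_2)$ and $K(t_1t_2)$ otherwise; nested abstractions $\lambda w.\lambda f.\lambda x.t$ are computed from the inside out. Define ${\bf tagged}\{f,t\} = S(S(KK)f)\big(S(S(KK)(KK))(Kt)\big)$, ${\bf wait2}\{M,N,P\} = S(S(S(KM)(KN))(KP))I$, and ${\bf Z\_tag} = K$. Let $w, f, x$ be distinct variables and define the closed term $\omega = \lambda w.\lambda f.\lambda x.\; f\;{\bf tagged}\{{\bf tagged}\{{\bf wait2}\{w,w,f\}, {\bf Z\_tag}\}, K x\}\;x$. For a term $f$, define $Z\{f\} = {\bf tagged}\{{\bf wait2}\{\omega,\omega,f\}, {\bf Z\_tag}\}$. *)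

theory Defs
  imports Main
begin

datatype 'v cterm =
    S
  | K
  | App "'v cterm" "'v cterm" (infixl \<open>\<cdot>\<close> 100)
  | Var 'v

inductive step :: "'v cterm \<Rightarrow> 'v cterm \<Rightarrow> bool" (infix \<open>\<rightarrow>\<^sub>1\<close> 50) where
  S_rule: "S \<cdot> M \<cdot> N \<cdot> P \<rightarrow>\<^sub>1 M \<cdot> P \<cdot> (N \<cdot> P)"
| K_rule: "K \<cdot> M \<cdot> N \<rightarrow>\<^sub>1 M"
| App_left: "M \<rightarrow>\<^sub>1 M' \<Longrightarrow> M \<cdot> N \<rightarrow>\<^sub>1 M' \<cdot> N"
| App_right: "N \<rightarrow>\<^sub>1 N' \<Longrightarrow> M \<cdot> N \<rightarrow>\<^sub>1 M \<cdot> N'"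

abbreviation reduces :: "'v cterm \<Rightarrow> 'v cterm \<Rightarrow> bool" (infix \<open>\<rightarrow>\<^sup>*\<close> 50) where
  "reduces \<equiv> step\<^sup>*\<^sup>*"

definition I :: "'v cterm" where
  "I = S \<cdot> K \<cdot> K"

primrec fv :: "'v cterm \<Rightarrow> 'v set" where
  "fv S = {}"
| "fv K = {}"
| "fv (t\<^sub>1 \<cdot> t\<^sub>2) = fv t\<^sub>1 \<union> fv t\<^sub>2"
| "fv (Var y) = {y}"

primrec star :: "'v \<Rightarrow> 'v cterm \<Rightarrow> 'v cterm" where
  "star x S = K \<cdot> S"
| "star x K = K \<cdot> K"
| "star x (t\<^sub>1 \<cdot> t\<^sub>2) =
     (if x \<in> fv (t\<^sub>1 \<cdot> t\<^sub>2) then S \<cdot> star x t\<^sub>1 \<cdot> star x t\<^sub>2 else K \<cdot> (t\<^sub>1 \<cdot> t\<^sub>2))"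
| "star x (Var y) = (if y = x then I else K \<cdot> Var y)"

definition tagged :: "'v cterm \<Rightarrow> 'v cterm \<Rightarrow> 'v cterm" where
  "tagged f t = S \<cdot> (S \<cdot> (K \<cdot> K) \<cdot> f) \<cdot> (S \<cdot> (S \<cdot> (K \<cdot> K) \<cdot> (K \<cdot> K)) \<cdot> (K \<cdot> t))"

definition wait2 :: "'v cterm \<Rightarrow> 'v cterm \<Rightarrow> 'v cterm \<Rightarrow> 'v cterm" where
  "wait2 M N P = S \<cdot> (S \<cdot> (S \<cdot> (K \<cdot> M) \<cdot> (K \<cdot> N)) \<cdot> (K \<cdot> P)) \<cdot> I"

definition Z_tag :: "'v cterm" where
  "Z_tag = K"

(* The names of the bound variables are explicit parameters, meant to be pairwise distinct. *)
definition omega :: "'v \<Rightarrow> 'v \<Rightarrow> 'v \<Rightarrow> 'v cterm" where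
  "omega w f x =
     star w (star f (star x
       (Var f \<cdot> tagged (tagged (wait2 (Var w) (Var w) (Var f)) Z_tag) (K \<cdot> Var x) \<cdot> Var x)))"

(* Z w f x t is the term Z{t}, with omega built from the variables w, f, x. *)
definition Z :: "'v \<Rightarrow> 'v \<Rightarrow> 'v \<Rightarrow> 'v cterm \<Rightarrow> 'v cterm" where
  "Z w f x t = tagged (wait2 (omega w f x) (omega w f x) t) Z_tag"

end

theory Submission
  imports Defs
begin

text \<open>
  Reducing \<open>star x b\<close>, under an arbitrary simultaneous substitution \<open>\<sigma>\<close> and applied to \<open>u\<close>,
  yields \<open>b\<close> under \<open>\<sigma>(x := u)\<close>. Since \<open>\<sigma>\<close> is applied after the abstraction has been translated
  to combinators, no capture can occur, so \<open>t\<close> may contain \<open>x\<close>. The term \<open>Z{t} u\<close> thus first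
  unwraps to \<open>\<omega> \<omega> t u\<close>, and three such steps turn this into the body of \<open>\<omega>\<close>, in which
  \<open>Z{t}\<close> reappears syntactically.
\<close>

primrec subst :: "('v \<Rightarrow> 'v cterm) \<Rightarrow> 'v cterm \<Rightarrow> 'v cterm" where
  "subst \<sigma> S = S"
| "subst \<sigma> K = K"
| "subst \<sigma> (t\<^sub>1 \<cdot> t\<^sub>2) = subst \<sigma> t\<^sub>1 \<cdot> subst \<sigma> t\<^sub>2"
| "subst \<sigma> (Var y) = \<sigma> y"

lemma subst_Var [simp]: "subst Var t = t"
  by (induction t) auto

lemma subst_upd_fresh: "x \<notin> fv t \<Longrightarrow> subst (\<sigma>(x := u)) t = subst \<sigma> t"
  by (induction t) auto

lemma reduces_app_left: "M \<rightarrow>\<^sup>* M' \<Longrightarrow> M \<cdot> N \<rightarrow>\<^sup>* M' \<cdot> N"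
  by (induction rule: rtranclp_induct) (auto intro: rtranclp.rtrancl_into_rtrancl App_left)

lemma reduces_app_right: "N \<rightarrow>\<^sup>* N' \<Longrightarrow> M \<cdot> N \<rightarrow>\<^sup>* M \<cdot> N'"
  by (induction rule: rtranclp_induct) (auto intro: rtranclp.rtrancl_into_rtrancl App_right)

lemma reduces_app: "M \<rightarrow>\<^sup>* M' \<Longrightarrow> N \<rightarrow>\<^sup>* N' \<Longrightarrow> M \<cdot> N \<rightarrow>\<^sup>* M' \<cdot> N'"
  by (meson reduces_app_left reduces_app_right rtranclp_trans)

lemma reduces_K: "M \<rightarrow>\<^sup>* M' \<Longrightarrow> K \<cdot> M \<cdot> N \<rightarrow>\<^sup>* M'"
  by (rule converse_rtranclp_into_rtranclp[where r = step, OF K_rule])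

lemma reduces_S: "M \<cdot> P \<rightarrow>\<^sup>* Q \<Longrightarrow> N \<cdot> P \<rightarrow>\<^sup>* R \<Longrightarrow> S \<cdot> M \<cdot> N \<cdot> P \<rightarrow>\<^sup>* Q \<cdot> R"
  by (rule converse_rtranclp_into_rtranclp[where r = step, OF S_rule]) (rule reduces_app)

lemma reduces_I: "I \<cdot> u \<rightarrow>\<^sup>* u"
  unfolding I_def
  by (rule converse_rtranclp_into_rtranclp[where r = step, OF S_rule]) (rule reduces_K, rule rtranclp.rtrancl_refl)

text \<open>Allowing any \<open>\<sigma>\<close> makes the lemma iterable: once an outer abstraction
  is applied, the inner ones stand under the substitution accumulated so far.\<close>

lemma star_beta: "subst \<sigma> (star x b) \<cdot> u \<rightarrow>\<^sup>* subst (\<sigma>(x := u)) b"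
proof (induction b)
  case (App b\<^sub>1 b\<^sub>2)
  show ?case
  proof (cases "x \<in> fv (b\<^sub>1 \<cdot> b\<^sub>2)")
    case True
    with App show ?thesis by (simp add: reduces_S)
  next
    case False
    then show ?thesis
      \<comment> \<open>Here \<open>star\<close> yields
        \<open>K \<cdot> (b\<^sub>1 \<cdot> b\<^sub>2)\<close>, which discards \<open>u\<close>; the
        update at \<open>x\<close> is equally invisible.\<close>
      unfolding subst_upd_fresh[OF False] by (simp add: reduces_K)
  qed
next
  case (Var y)
  have "subst \<sigma> I = I" by (simp add: I_def)
  then show ?case by (simp add: reduces_I reduces_K)
qed (simp_all add: reduces_K)

lemma tagged_reduces: "tagged M T \<cdot> u \<rightarrow>\<^sup>* M \<cdot> u"
proof -
  \<comment> \<open>The half carrying the tag: the other half turns \<open>u\<close> into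
    \<open>K \<cdot> (M \<cdot> u)\<close>, which erases \<open>N \<cdot> u\<close>.\<close>
  define N where "N = S \<cdot> (S \<cdot> (K \<cdot> K) \<cdot> (K \<cdot> K)) \<cdot> (K \<cdot> T)"
  have "tagged M T \<cdot> u \<rightarrow>\<^sup>* K \<cdot> (M \<cdot> u) \<cdot> (N \<cdot> u)"
    unfolding tagged_def N_def by (intro reduces_S reduces_K rtranclp.rtrancl_refl)
  also have "\<dots> \<rightarrow>\<^sup>* M \<cdot> u"
    by (intro reduces_K rtranclp.rtrancl_refl)
  finally show ?thesis .
qed

text \<open>Each \<open>K\<close> releases its stored term and drops its copy of \<open>u\<close>;
  the final \<open>I\<close> passes \<open>u\<close> on.\<close>

lemma wait2_reduces: "wait2 M N P \<cdot> u \<rightarrow>\<^sup>* M \<cdot> N \<cdot> P \<cdot> u"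
  unfolding wait2_def by (intro reduces_S reduces_K reduces_I rtranclp.rtrancl_refl)

lemma subst_tagged: "subst \<sigma> (tagged M T) = tagged (subst \<sigma> M) (subst \<sigma> T)"
  by (simp add: tagged_def)

lemma subst_wait2: "subst \<sigma> (wait2 M N P) = wait2 (subst \<sigma> M) (subst \<sigma> N) (subst \<sigma> P)"
  by (simp add: wait2_def I_def)

theorem mainTheorem3:
  fixes w f x :: 'v and t u :: "'v cterm"
  assumes "distinct [w, f, x]"
  shows "Z w f x t \<cdot> u \<rightarrow>\<^sup>* t \<cdot> tagged (Z w f x t) (K \<cdot> u) \<cdot> u"
proof -
  define b where
    "b = Var f \<cdot> tagged (tagged (wait2 (Var w) (Var w) (Var f)) Z_tag) (K \<cdot> Var x) \<cdot> Var x"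
  define \<Omega> where "\<Omega> = omega w f x"
  \<comment> \<open>The identity substitution brings \<open>\<Omega>\<close> into the shape required
    by \<open>star_beta\<close>.\<close>
  have \<Omega>: "\<Omega> = subst Var (star w (star f (star x b)))"
    by (simp add: \<Omega>_def omega_def b_def)
  have "Z w f x t \<cdot> u \<rightarrow>\<^sup>* wait2 \<Omega> \<Omega> t \<cdot> u"
    unfolding Z_def \<Omega>_def by (rule tagged_reduces)
  also have "\<dots> \<rightarrow>\<^sup>* \<Omega> \<cdot> \<Omega> \<cdot> t \<cdot> u"
    by (rule wait2_reduces)
  also have "\<dots> \<rightarrow>\<^sup>* subst (Var(w := \<Omega>)) (star f (star x b)) \<cdot> t \<cdot> u"
    \<comment> \<open>Only the head \<open>\<Omega>\<close> is expanded; the argument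
      \<open>\<Omega>\<close> stays folded as the value of \<open>w\<close>.\<close>
    by (intro reduces_app_left) (subst (1) \<Omega>, rule star_beta)
  also have "\<dots> \<rightarrow>\<^sup>* subst (Var(w := \<Omega>, f := t)) (star x b) \<cdot> u"
    by (intro reduces_app_left star_beta)
  also have "\<dots> \<rightarrow>\<^sup>* subst (Var(w := \<Omega>, f := t, x := u)) b"
    by (rule star_beta)
  also have "subst (Var(w := \<Omega>, f := t, x := u)) b = t \<cdot> tagged (Z w f x t) (K \<cdot> u) \<cdot> u"
    \<comment> \<open>Distinctness ensures that no update overwrites an earlier one.\<close>
    using assms by (simp add: b_def subst_tagged subst_wait2 Z_def Z_tag_def \<Omega>_def)
  finally show ?thesis .
qed

end
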